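(* (a) There is a quantifier-free, parameter-free insertion query $\rho$ over the graph schema such that $(q_{\mathrm{Reach}},\{\mathrm{ins}_E(\bar p),\rho\})$ cannot be maintained in DynFO on ordered directed graphs by any dynamic program all of whose auxiliary relations, other than the (binary) query relation and the built-in linear order, are unary. (b) There is an $\mathrm{FO}[\exists^*]$-definable, parameter-free insertion query $\rho'$ such that the same statement holds for $(q_{\mathrm{Reach}},\{\mathrm{ins}_E(\bar p),\rho'\})$ even when restricted to acyclic directed graphs.
   Context: Framework. A replacement rule for a relation symbol $R$ is $R := \mu_R(\bar p;\bar x)$ with $\mu_R$ first-order; a replacement query $\rho(\bar p)$ is a set of such rules for distinct relations with a common parameter tuple $\bar p$ (parameter-free if $\bar p$ is empty; quantifier-free, resp. $\mathrm{FO}[\exists^*]$, if all formulas are quantifier-free, resp. existential). A change $\rho(\bar a)$ replaces each ruled relation $R$ by $\{\bar b:\mathcal D\models\mu_R(\bar a;\bar b)\}$. An insertion query has all $\mu_R$ of the form $R(\bar x)\lor\varphi_R$. $\mathrm{ins}_E(\bar p)$ is the single-edge insertion $E:=E(x,y)\lor (x,y)=\bar p$. A dynamic program operates on states of an input database and an auxiliary database over a fixed finite domain; for each allowed replacement query $\rho(\bar p)$ and auxiliary symbol $T$ it has an update formula $\varphi_T(\bar p;\bar x)$ over input and auxiliary schema, and after change $\rho(\bar a)$ the input is replaced by its image and $T$ becomes $\{\bar b:\text{old state}\models\varphi_T(\bar a,\bar b)\}$. It maintains $(q,\Delta)$ if an auxiliary relation $Q$ equals $q$ of the current input after every nonempty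 sequence of changes from $\Delta$ starting from the empty input and empty auxiliary database. DynFO: first-order update formulas. For a restricted class of inputs (acyclic graphs), only change sequences keeping the input in the class are considered. $q_{\mathrm{Reach}}$ maps a directed graph to the set of pairs $(u,v)$ with a directed path from $u$ to $v$. An ordered directed graph has, in addition to $E$, a built-in linear order on its nodes which is never changed. *)

theory Defs
  imports Main
begin

text \<open>Variables are natural numbers. Structures have domain {0..<n}; the built-in
linear order of an ordered graph is the natural order on {0..<n} (every finite linear
order is isomorphic to one of these, and FO semantics is isomorphism invariant).\<close>

datatype 's fo =
    Atom 's "nat list"
  | Eq nat nat
  | Lt nat nat
  | Neg "'s fo"
  | Conj "'s fo" "'s fo"
  | Disj "'s fo" "'s fo"
  | Ex nat "'s fo"
  | All nat "'s fo"

fun eval :: "nat \<Rightarrow> ('s \<Rightarrow> nat list set) \<Rightarrow> (nat \<Rightarrow> nat) \<Rightarrow> 's fo \<Rightarrow> bool" where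
  "eval n I v (Atom s xs) = (map v xs \<in> I s)"
| "eval n I v (Eq i j) = (v i = v j)"
| "eval n I v (Lt i j) = (v i < v j)"
| "eval n I v (Neg \<phi>) = (\<not> eval n I v \<phi>)"
| "eval n I v (Conj \<phi> \<psi>) = (eval n I v \<phi> \<and> eval n I v \<psi>)"
| "eval n I v (Disj \<phi> \<psi>) = (eval n I v \<phi> \<or> eval n I v \<psi>)"
| "eval n I v (Ex i \<phi>) = (\<exists>a<n. eval n I (v(i := a)) \<phi>)"
| "eval n I v (All i \<phi>) = (\<forall>a<n. eval n I (v(i := a)) \<phi>)"

fun fv :: "'s fo \<Rightarrow> nat set" where
  "fv (Atom s xs) = set xs"
| "fv (Eq i j) = {i, j}"
| "fv (Lt i j) = {i, j}"
| "fv (Neg \<phi>) = fv \<phi>"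
| "fv (Conj \<phi> \<psi>) = fv \<phi> \<union> fv \<psi>"
| "fv (Disj \<phi> \<psi>) = fv \<phi> \<union> fv \<psi>"
| "fv (Ex i \<phi>) = fv \<phi> - {i}"
| "fv (All i \<phi>) = fv \<phi> - {i}"

fun syms :: "'s fo \<Rightarrow> 's set" where
  "syms (Atom s xs) = {s}"
| "syms (Eq i j) = {}"
| "syms (Lt i j) = {}"
| "syms (Neg \<phi>) = syms \<phi>"
| "syms (Conj \<phi> \<psi>) = syms \<phi> \<union> syms \<psi>"
| "syms (Disj \<phi> \<psi>) = syms \<phi> \<union> syms \<psi>"
| "syms (Ex i \<phi>) = syms \<phi>"
| "syms (All i \<phi>) = syms \<phi>"

fun uses_order :: "'s fo \<Rightarrow> bool" where
  "uses_order (Atom s xs) = False"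
| "uses_order (Eq i j) = False"
| "uses_order (Lt i j) = True"
| "uses_order (Neg \<phi>) = uses_order \<phi>"
| "uses_order (Conj \<phi> \<psi>) = (uses_order \<phi> \<or> uses_order \<psi>)"
| "uses_order (Disj \<phi> \<psi>) = (uses_order \<phi> \<or> uses_order \<psi>)"
| "uses_order (Ex i \<phi>) = uses_order \<phi>"
| "uses_order (All i \<phi>) = uses_order \<phi>"

fun qfree :: "'s fo \<Rightarrow> bool" where
  "qfree (Atom s xs) = True"
| "qfree (Eq i j) = True"
| "qfree (Lt i j) = True"
| "qfree (Neg \<phi>) = qfree \<phi>"
| "qfree (Conj \<phi> \<psi>) = (qfree \<phi> \<and> qfree \<psi>)"
| "qfree (Disj \<phi> \<psi>) = (qfree \<phi> \<and> qfree \<psi>)"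
| "qfree (Ex i \<phi>) = False"
| "qfree (All i \<phi>) = False"

definition existential :: "'s fo \<Rightarrow> bool" where
  "existential \<phi> \<longleftrightarrow> (\<exists>xs \<psi>. \<phi> = foldr Ex xs \<psi> \<and> qfree \<psi>)"

datatype asym = Qs | Us nat

datatype sym = Es | Aux asym

fun ar :: "asym \<Rightarrow> nat" where
  "ar Qs = 2"
| "ar (Us i) = 1"

definition aux_in :: "nat \<Rightarrow> asym \<Rightarrow> bool" where
  "aux_in k a \<longleftrightarrow> a = Qs \<or> (\<exists>i<k. a = Us i)"

definition schema :: "nat \<Rightarrow> sym set" where
  "schema k = {Es} \<union> {Aux a | a. aux_in k a}"

datatype chg = InsE | RhoC

fun npar :: "chg \<Rightarrow> nat" where
  "npar InsE = 2"
| "npar RhoC = 0"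

definition lval :: "nat list \<Rightarrow> nat \<Rightarrow> nat" where
  "lval xs i = (if i < length xs then xs ! i else 0)"

type_synonym state = "(nat \<times> nat) set \<times> (asym \<Rightarrow> nat list set)"

definition interp :: "state \<Rightarrow> sym \<Rightarrow> nat list set" where
  "interp st s = (case s of Es \<Rightarrow> {[a, b] | a b. (a, b) \<in> fst st} | Aux a \<Rightarrow> snd st a)"

definition new_input :: "nat \<Rightarrow> sym fo \<Rightarrow> state \<Rightarrow> chg \<Rightarrow> nat list \<Rightarrow> (nat \<times> nat) set" where
  "new_input n \<rho> st c ps = (case c of
      InsE \<Rightarrow> fst st \<union> {(ps ! 0, ps ! 1)}
    | RhoC \<Rightarrow> fst st \<union> {(u, v). u < n \<and> v < n \<and> eval n (interp st) (lval [u, v]) \<rho>})"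

text \<open>Update formula upd c a has parameters = variables 0..<npar c and the tuple x
= variables npar c ..< npar c + ar a.\<close>
definition step :: "nat \<Rightarrow> sym fo \<Rightarrow> nat \<Rightarrow> (chg \<Rightarrow> asym \<Rightarrow> sym fo)
                     \<Rightarrow> state \<Rightarrow> chg \<times> nat list \<Rightarrow> state" where
  "step n \<rho> k upd st ch = (case ch of (c, ps) \<Rightarrow>
     (new_input n \<rho> st c ps,
      \<lambda>a. if aux_in k a
          then {bs. length bs = ar a \<and> set bs \<subseteq> {..<n} \<and> eval n (interp st) (lval (ps @ bs)) (upd c a)}
          else {}))"

definition init_state :: state where
  "init_state = ({}, \<lambda>_. {})"

definition run :: "nat \<Rightarrow> sym fo \<Rightarrow> nat \<Rightarrow> (chg \<Rightarrow> asym \<Rightarrow> sym fo)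
                    \<Rightarrow> (chg \<times> nat list) list \<Rightarrow> state" where
  "run n \<rho> k upd cs = foldl (step n \<rho> k upd) init_state cs"

definition valid_chg :: "nat \<Rightarrow> chg \<times> nat list \<Rightarrow> bool" where
  "valid_chg n ch \<longleftrightarrow> length (snd ch) = npar (fst ch) \<and> set (snd ch) \<subseteq> {..<n}"

definition wf_prog :: "nat \<Rightarrow> (chg \<Rightarrow> asym \<Rightarrow> sym fo) \<Rightarrow> bool" where
  "wf_prog k upd \<longleftrightarrow> (\<forall>c a. aux_in k a \<longrightarrow>
      syms (upd c a) \<subseteq> schema k \<and> fv (upd c a) \<subseteq> {..< npar c + ar a})"

definition reach :: "nat \<Rightarrow> (nat \<times> nat) set \<Rightarrow> nat list set" where
  "reach n E = {[u, v] | u v. u < n \<and> v < n \<and> (u, v) \<in> E\<^sup>*}"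

definition maintains :: "((nat \<times> nat) set \<Rightarrow> bool) \<Rightarrow> sym fo \<Rightarrow> nat
                          \<Rightarrow> (chg \<Rightarrow> asym \<Rightarrow> sym fo) \<Rightarrow> bool" where
  "maintains cls \<rho> k upd \<longleftrightarrow>
     (\<forall>n cs. cs \<noteq> [] \<and> (\<forall>ch\<in>set cs. valid_chg n ch)
        \<and> (\<forall>i\<le>length cs. cls (fst (run n \<rho> k upd (take i cs))))
        \<longrightarrow> snd (run n \<rho> k upd cs) Qs = reach n (fst (run n \<rho> k upd cs)))"

definition graph_query :: "sym fo \<Rightarrow> bool" where
  "graph_query \<phi> \<longleftrightarrow> syms \<phi> \<subseteq> {Es} \<and> \<not> uses_order \<phi> \<and> fv \<phi> \<subseteq> {0, 1}"

end

theory Submission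
  imports Defs
begin

text \<open>Take many disjoint copies (columns) of one long zigzag and order the nodes layer by layer.
  Every path in this graph has length at most 2, so the query relation carries only local
  information. A single application of the change query joins the first and the last node of
  each column, so the update formula for the query relation has to decide, from the graph, the order
  and unary relations, whether a node of the first layer and a node of the last layer lie in
  the same column. If the columns are longer than the formula can look, it sees each of these two
  nodes separately, through the type of its column in the word of column colours (a colour records
  the unary relations on one column). With more columns than types, two columns have equal type,
  and exchanging one for the other in the last layer is invisible to the formula.\<close>

section \<open>Ehrenfeucht games on coloured linear orders\<close>

text \<open>Any two pairs are compared in both orders and \<open><\<close> is total, so equality of
  positions is preserved as well.\<close>

definition partial_iso :: "(nat \<Rightarrow> 'c) \<Rightarrow> (nat \<times> nat) set \<Rightarrow> bool" where
  "partial_iso w P \<longleftrightarrow>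
     (\<forall>(x, x')\<in>P. w x = w x' \<and> (\<forall>(y, y')\<in>P. x < y \<longleftrightarrow> x' < y'))"

text \<open>A position is a set of pairs rather than two tuples, so pebbles are forgotten by passing
  to a subset.\<close>

fun ef :: "nat \<Rightarrow> (nat \<Rightarrow> 'c) \<Rightarrow> nat \<Rightarrow> (nat \<times> nat) set \<Rightarrow> bool" where
  "ef m w 0 P = partial_iso w P"
| "ef m w (Suc r) P =
     ((\<forall>a<m. \<exists>b<m. ef m w r (insert (a, b) P)) \<and>
      (\<forall>b<m. \<exists>a<m. ef m w r (insert (a, b) P)))"

lemma ef_mono: "ef m w r P \<Longrightarrow> P' \<subseteq> P \<Longrightarrow> ef m w r P'"
proof (induction r arbitrary: P P')
  case 0
  then show ?case unfolding partial_iso_def ef.simps by blast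
next
  case (Suc r)
  have "ef m w r (insert (a, b) P')" if "ef m w r (insert (a, b) P)" for a b
    by (rule Suc.IH[OF that]) (use Suc.prems(2) in blast)
  then show ?case using Suc.prems(1) unfolding ef.simps by meson
qed

text \<open>One round is spent on an arbitrary element, whose pebble is then forgotten. On an empty
  board there is no such element and the longer game is won vacuously.\<close>

lemma ef_Suc: "m > 0 \<Longrightarrow> ef m w (Suc r) P \<Longrightarrow> ef m w r P"
  by (meson ef.simps(2) ef_mono subset_insertI)

lemma ef_partial_iso: "m > 0 \<Longrightarrow> ef m w r P \<Longrightarrow> partial_iso w P"
proof (induction r)
  case (Suc r)
  then show ?case using ef_Suc by blast
qed simp

lemma ef_converse: "ef m w r P \<Longrightarrow> ef m w r (P\<inverse>)"
proof (induction r arbitrary: P)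
  case 0
  then show ?case unfolding partial_iso_def ef.simps by auto
next
  case (Suc r)
  have "ef m w r (insert (b, a) (P\<inverse>))" if "ef m w r (insert (a, b) P)" for a b
  proof -
    have "(insert (a, b) P)\<inverse> = insert (b, a) (P\<inverse>)" by auto
    then show ?thesis using Suc.IH[OF that] by simp
  qed
  then show ?case using Suc.prems unfolding ef.simps by meson
qed

text \<open>Every move is answered by its copy.\<close>

lemma ef_identity: "P \<subseteq> Id \<Longrightarrow> ef m w r P"
proof (induction r arbitrary: P)
  case 0
  then show ?case by (auto simp: partial_iso_def)
next
  case (Suc r)
  have "ef m w r (insert (a, a) P)" for a
    by (rule Suc.IH) (use Suc.prems in auto)
  then show ?case by auto
qed

text \<open>Game types of rank \<open>Suc r\<close> are sets of types of rank \<open>r\<close>.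
  Coding them by numbers keeps all ranks in one HOL type, as the induction below requires.\<close>

lemma finite_codomain_nat:
  assumes "finite D"
  obtains h :: "'d \<Rightarrow> nat" where "inj_on h D" "h ` D \<subseteq> {..<card D}"
proof -
  obtain h where "bij_betw h D {0..<card D}"
    using ex_bij_betw_finite_nat[OF assms] by blast
  then show thesis using that[of h] by (auto simp: bij_betw_def atLeast0LessThan)
qed

text \<open>\<open>N\<close> must not depend on \<open>m\<close>: in the application the number \<open>m\<close> of columns exceeds \<open>N\<close>.\<close>

lemma ef_finite_index:
  fixes C :: "'c set"
  assumes "finite C"
  shows "\<exists>N::nat. \<forall>m w. range w \<subseteq> C \<longrightarrow>
    (\<exists>f. \<forall>xs. length xs = p \<longrightarrow> f xs < N \<and>
      (\<forall>ys. length ys = p \<longrightarrow> f xs = f ys \<longrightarrow> ef m w r (set (zip xs ys))))"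
proof (induction r arbitrary: p)
  case 0
  \<comment> \<open>With no rounds left, a tuple is classified by its order pattern and its colours;
    \<open>D\<close> holds all such data for every \<open>m\<close> at once.\<close>
  define D where "D = Pow ({..<p} \<times> {..<p}) \<times> {cs. set cs \<subseteq> C \<and> length cs = p}"
  have "finite D" using finite_lists_length_eq[OF assms] by (auto simp: D_def)
  then obtain h :: "_ \<Rightarrow> nat" where h: "inj_on h D" "h ` D \<subseteq> {..<card D}"
    by (rule finite_codomain_nat)
  have "\<exists>f. \<forall>xs. length xs = p \<longrightarrow> f xs < card D \<and>
      (\<forall>ys. length ys = p \<longrightarrow> f xs = f ys \<longrightarrow> ef m w 0 (set (zip xs ys)))"
    if w: "range w \<subseteq> C" for m :: nat and w :: "nat \<Rightarrow> 'c"
  proof -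
    define g where "g xs = ({(i, j). i < p \<and> j < p \<and> xs ! i < xs ! j}, map w xs)" for xs
    have gD: "g xs \<in> D" if "length xs = p" for xs
      using that w by (auto simp: g_def D_def)
    have "partial_iso w (set (zip xs ys))"
      if l: "length xs = p" "length ys = p" and "h (g xs) = h (g ys)" for xs ys
    proof -
      have "g xs = g ys" using inj_onD[OF h(1)] gD that by simp
      then have *: "\<And>i j. i < p \<Longrightarrow> j < p \<Longrightarrow> xs ! i < xs ! j \<longleftrightarrow> ys ! i < ys ! j"
        and "map w xs = map w ys"
        by (auto simp: g_def set_eq_iff)
      then have "w (xs ! i) = w (ys ! i)" if "i < p" for i
        using that l by (metis nth_map)
      with * show ?thesis using l by (auto simp: partial_iso_def set_zip)
    qed
    then show ?thesis using gD h(2)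
      by (intro exI[of _ "\<lambda>xs. h (g xs)"]) (auto simp: image_subset_iff)
  qed
  then show ?case by blast
next
  case (Suc r)
  obtain N :: nat where N: "\<And>m w. range w \<subseteq> C \<Longrightarrow>
    \<exists>f. \<forall>xs. length xs = Suc p \<longrightarrow> f xs < N \<and>
      (\<forall>ys. length ys = Suc p \<longrightarrow> f xs = f ys \<longrightarrow> ef m w r (set (zip xs ys)))"
    using Suc.IH[of "Suc p"] by blast
  \<comment> \<open>The new class of a tuple is the set of old classes of its one-point extensions,
    so the new bound depends on \<open>N\<close> alone.\<close>
  define D where "D = Pow {..<N}"
  have "finite D" by (simp add: D_def)
  then obtain h :: "_ \<Rightarrow> nat" where h: "inj_on h D" "h ` D \<subseteq> {..<card D}"
    by (rule finite_codomain_nat)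
  have "\<exists>f. \<forall>xs. length xs = p \<longrightarrow> f xs < card D \<and>
      (\<forall>ys. length ys = p \<longrightarrow> f xs = f ys \<longrightarrow> ef m w (Suc r) (set (zip xs ys)))"
    if w: "range w \<subseteq> C" for m w
  proof -
    obtain f where f: "\<And>xs. length xs = Suc p \<Longrightarrow> f xs < N"
      "\<And>xs ys. length xs = Suc p \<Longrightarrow> length ys = Suc p \<Longrightarrow> f xs = f ys \<Longrightarrow>
        ef m w r (set (zip xs ys))"
      using N[OF w, of m] by blast
    define g where "g xs = (\<lambda>a. f (a # xs)) ` {..<m}" for xs
    have gD: "g xs \<in> D" if "length xs = p" for xs
      using that f(1) by (auto simp: g_def D_def)
    have "ef m w (Suc r) (set (zip xs ys))"
      if l: "length xs = p" "length ys = p" and "h (g xs) = h (g ys)" for xs ys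
    proof -
      have g: "g xs = g ys" using inj_onD[OF h(1)] gD that by simp
      have *: "ef m w r (insert (a, b) (set (zip xs ys)))" if "f (a # xs) = f (b # ys)" for a b
        using f(2)[of "a # xs" "b # ys"] that l by simp
      have "\<exists>b<m. ef m w r (insert (a, b) (set (zip xs ys)))" if "a < m" for a
      proof -
        have "f (a # xs) \<in> g ys" using g that by (auto simp: g_def)
        then show ?thesis using * by (auto simp: g_def)
      qed
      moreover have "\<exists>a<m. ef m w r (insert (a, b) (set (zip xs ys)))" if "b < m" for b
      proof -
        have "f (b # ys) \<in> g xs" using g that by (auto simp: g_def)
        then obtain a where "a < m" "f (a # xs) = f (b # ys)" by (auto simp: g_def)
        then show ?thesis using * by blast
      qed
      ultimately show ?thesis by simp
    qed
    then show ?thesis using gD h(2)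
      by (intro exI[of _ "\<lambda>xs. h (g xs)"]) (auto simp: image_subset_iff)
  qed
  then show ?case by blast
qed

section \<open>Structures made of identical columns\<close>

text \<open>Node \<open>i * m + a\<close> sits in layer \<open>i\<close> and column \<open>a\<close>, so the built-in order compares
  layers first and columns second.\<close>

definition columns :: "nat \<Rightarrow> (nat \<times> nat) set \<Rightarrow> (nat \<times> nat) set" where
  "columns m F = {(x, y). x mod m = y mod m \<and> (x div m, y div m) \<in> F}"

lemma columns_node: "a < m \<Longrightarrow> b < m \<Longrightarrow>
    (i * m + a, j * m + b) \<in> columns m F \<longleftrightarrow> a = b \<and> (i, j) \<in> F"
  by (auto simp: columns_def)

lemma columns_cases:
  assumes "(x, y) \<in> columns m F" "m > 0"
  obtains i j a where "a < m" "x = i * m + a" "y = j * m + a" "(i, j) \<in> F"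
  using assms by (intro that[of "x mod m" "x div m" "y div m"]) (auto simp: columns_def, metis div_mult_mod_eq)

lemma columns_bounded:
  assumes "m > 0" "F \<subseteq> {..<l} \<times> {..<l}"
  shows "columns m F \<subseteq> {..<l * m} \<times> {..<l * m}"
  using assms by (auto simp: columns_def div_less_iff_less_mult)

text \<open>A path never leaves its column, so reachability reduces to reachability between the
  layers of a single column.\<close>

lemma columns_rtrancl:
  assumes "m > 0"
  shows "(columns m F)\<^sup>* = columns m (F\<^sup>*)"
proof (intro equalityI subrelI)
  fix x y assume "(x, y) \<in> (columns m F)\<^sup>*"
  then show "(x, y) \<in> columns m (F\<^sup>*)"
    by (induction rule: rtrancl_induct) (auto simp: columns_def intro: rtrancl_into_rtrancl)
next
  fix x y assume "(x, y) \<in> columns m (F\<^sup>*)"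
  then obtain i j a where a: "a < m" "x = i * m + a" "y = j * m + a" and "(i, j) \<in> F\<^sup>*"
    using assms by (rule columns_cases)
  from this(4) have "(i * m + a, j * m + a) \<in> (columns m F)\<^sup>*"
  proof (induction rule: rtrancl_induct)
    case (step j k)
    then have "(j * m + a, k * m + a) \<in> columns m F" using a by (simp add: columns_node)
    with step.IH show ?case by (rule rtrancl_into_rtrancl)
  qed simp
  then show "(x, y) \<in> (columns m F)\<^sup>*" using a by simp
qed

section \<open>Indistinguishability of nodes in column structures\<close>

fun qrank :: "'s fo \<Rightarrow> nat" where
  "qrank (Neg \<phi>) = qrank \<phi>"
| "qrank (Conj \<phi> \<psi>) = max (qrank \<phi>) (qrank \<psi>)"
| "qrank (Disj \<phi> \<psi>) = max (qrank \<phi>) (qrank \<psi>)"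
| "qrank (Ex i \<phi>) = Suc (qrank \<phi>)"
| "qrank (All i \<phi>) = Suc (qrank \<phi>)"
| "qrank _ = 0"

text \<open>The span of two layers fits the hard graph as well as its reachability relation, so
  \<open>Es\<close> and \<open>Qs\<close> are treated alike; the second alternative covers the unary
  auxiliary relations.\<close>

locale column_structure =
  fixes m l :: nat and I :: "'s \<Rightarrow> nat list set" and \<Sigma> :: "'s set"
  assumes m_pos: "m > 0"
    and relations: "s \<in> \<Sigma> \<Longrightarrow>
      (\<exists>R. (\<forall>(i, j)\<in>R. i \<le> j + 2 \<and> j \<le> i + 2) \<and> I s = {[x, y] | x y. (x, y) \<in> columns m R})
      \<or> I s \<subseteq> range (\<lambda>x. [x])"
begin

text \<open>The alphabet is bounded in terms of \<open>\<Sigma>\<close> and \<open>l\<close>,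
  whatever the number \<open>m\<close> of columns.\<close>

definition colour :: "nat \<Rightarrow> ('s \<times> nat) set" where
  "colour a = {(s, i). s \<in> \<Sigma> \<and> i < l \<and> [i * m + a] \<in> I s}"

definition column_pairs :: "(nat \<Rightarrow> nat) \<Rightarrow> (nat \<Rightarrow> nat) \<Rightarrow> nat set \<Rightarrow> (nat \<times> nat) set" where
  "column_pairs v v' T = (\<lambda>x. (v x mod m, v' x mod m)) ` T"

text \<open>Pebbles stay in their layers and form a low and a high cluster. The two clusters are so
  far apart that no relation links them, so the columns of each cluster can be played
  independently. A new pebble joins the nearer cluster, which at most halves the gap.\<close>

definition similar :: "nat \<Rightarrow> nat set \<Rightarrow> (nat \<Rightarrow> nat) \<Rightarrow> (nat \<Rightarrow> nat) \<Rightarrow> bool" where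
  "similar r S v v' \<longleftrightarrow> (\<exists>lo hi. lo + 3 * 2 ^ r \<le> hi \<and>
     (\<forall>x\<in>S. v x < l * m \<and> v' x < l * m \<and> v x div m = v' x div m \<and>
        (v x div m \<le> lo \<or> hi \<le> v x div m)) \<and>
     ef m colour r (column_pairs v v' {x\<in>S. v x div m \<le> lo}) \<and>
     ef m colour r (column_pairs v v' {x\<in>S. hi \<le> v x div m}))"

text \<open>Reduces both quantifier cases of \<open>eval_similar\<close> to a single
  direction.\<close>

lemma similar_sym:
  assumes "similar r S v v'"
  shows "similar r S v' v"
proof -
  have *: "column_pairs v' v T = (column_pairs v v' T)\<inverse>" for T
    by (auto simp: column_pairs_def)
  obtain lo hi where h: "lo + 3 * 2 ^ r \<le> hi"
     "\<forall>x\<in>S. v x < l * m \<and> v' x < l * m \<and> v x div m = v' x div m \<and>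
        (v x div m \<le> lo \<or> hi \<le> v x div m)"
     "ef m colour r (column_pairs v v' {x\<in>S. v x div m \<le> lo})"
     "ef m colour r (column_pairs v v' {x\<in>S. hi \<le> v x div m})"
    using assms unfolding similar_def by blast
  have "{x\<in>S. v' x div m \<le> lo} = {x\<in>S. v x div m \<le> lo}"
    "{x\<in>S. hi \<le> v' x div m} = {x\<in>S. hi \<le> v x div m}"
    using h(2) by auto
  then show ?thesis unfolding similar_def
    using h ef_converse[OF h(3)] ef_converse[OF h(4)] by (intro exI[of _ lo] exI[of _ hi]) (auto simp: *)
qed

text \<open>The reply stays in the layer of the move. Its column is the reply in the game of the
  cluster that the pebble joins, while the other game gives up a round.\<close>

lemma similar_extend:
  assumes "similar (Suc r) S v v'" "a < l * m"
  shows "\<exists>a'<l * m. similar r (insert i S) (v(i := a)) (v'(i := a'))"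
proof -
  obtain lo hi where h: "lo + 3 * 2 ^ Suc r \<le> hi"
     "\<forall>x\<in>S. v x < l * m \<and> v' x < l * m \<and> v x div m = v' x div m \<and>
        (v x div m \<le> lo \<or> hi \<le> v x div m)"
     "ef m colour (Suc r) (column_pairs v v' {x\<in>S. v x div m \<le> lo})"
     "ef m colour (Suc r) (column_pairs v v' {x\<in>S. hi \<le> v x div m})"
    using assms unfolding similar_def by blast
  define i' where "i' = a div m"
  have "i' < l" using assms(2) m_pos by (simp add: i'_def div_less_iff_less_mult)
  have node: "i' * m + b < l * m" "(i' * m + b) div m = i'" "(i' * m + b) mod m = b"
    if "b < m" for b
  proof -
    have "Suc i' * m \<le> l * m" using \<open>i' < l\<close> by (intro mult_le_mono1) simp
    then show "i' * m + b < l * m" using that by simp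
  qed (use that in auto)
  have am: "a mod m < m" using m_pos by simp
  show ?thesis
  proof (cases "i' \<le> lo + 3 * 2 ^ r")
    case True
    obtain b where b: "b < m"
      "ef m colour r (insert (a mod m, b) (column_pairs v v' {x\<in>S. v x div m \<le> lo}))"
      using h(3) am by auto
    define lo' where "lo' = max lo i'"
    define u u' where "u = v(i := a)" and "u' = v'(i := i' * m + b)"
    have gap: "lo' + 3 * 2 ^ r \<le> hi" using True h(1) by (auto simp: lo'_def)
    have "(0::nat) < 2 ^ r" by simp
    with gap have "lo' < hi" by linarith
    \<comment> \<open>Raising the threshold to \<open>lo'\<close> captures no high pebble because
      \<open>lo' < hi\<close>. Only an inclusion of positions holds, since reassigning
      \<open>i\<close> may erase an older pebble.\<close>
    have "ef m colour r (column_pairs u u' {x \<in> insert i S. u x div m \<le> lo'})"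
      by (rule ef_mono[OF b(2)])
        (use b(1) node h(2) \<open>lo' < hi\<close> in \<open>fastforce simp: column_pairs_def u_def u'_def\<close>)
    moreover have "ef m colour r (column_pairs u u' {x \<in> insert i S. hi \<le> u x div m})"
      by (rule ef_mono[OF ef_Suc[OF m_pos h(4)]])
        (use \<open>lo' < hi\<close> in \<open>auto simp: column_pairs_def u_def u'_def lo'_def i'_def\<close>)
    moreover have "\<forall>x\<in>insert i S. u x < l * m \<and> u' x < l * m \<and> u x div m = u' x div m \<and>
        (u x div m \<le> lo' \<or> hi \<le> u x div m)"
      using h(2) assms(2) node[OF b(1)] by (auto simp: u_def u'_def lo'_def i'_def)
    ultimately show ?thesis using gap node(1)[OF b(1)]
      unfolding similar_def u_def u'_def by blast
  next
    case False
    obtain b where b: "b < m"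
      "ef m colour r (insert (a mod m, b) (column_pairs v v' {x\<in>S. hi \<le> v x div m}))"
      using h(4) am by auto
    define hi' where "hi' = min hi i'"
    define u u' where "u = v(i := a)" and "u' = v'(i := i' * m + b)"
    have gap: "lo + 3 * 2 ^ r \<le> hi'" using False h(1) by (auto simp: hi'_def)
    have "(0::nat) < 2 ^ r" by simp
    with gap have "lo < hi'" by linarith
    have "ef m colour r (column_pairs u u' {x \<in> insert i S. hi' \<le> u x div m})"
      by (rule ef_mono[OF b(2)])
        (use b(1) node h(2) \<open>lo < hi'\<close> in \<open>fastforce simp: column_pairs_def u_def u'_def\<close>)
    moreover have "ef m colour r (column_pairs u u' {x \<in> insert i S. u x div m \<le> lo})"
      by (rule ef_mono[OF ef_Suc[OF m_pos h(3)]])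
        (use \<open>lo < hi'\<close> in \<open>auto simp: column_pairs_def u_def u'_def hi'_def i'_def\<close>)
    moreover have "\<forall>x\<in>insert i S. u x < l * m \<and> u' x < l * m \<and> u x div m = u' x div m \<and>
        (u x div m \<le> lo \<or> hi' \<le> u x div m)"
      using h(2) assms(2) node[OF b(1)] by (auto simp: u_def u'_def hi'_def i'_def)
    ultimately show ?thesis using gap node(1)[OF b(1)]
      unfolding similar_def u_def u'_def by blast
  qed
qed

text \<open>The clusters are at least three layers apart even for \<open>r = 0\<close>. Pebbles at
  most two layers apart thus lie in one cluster, and their columns are compared within one
  game.\<close>

lemma similar_atoms:
  assumes "similar r S v v'" "x \<in> S"
  shows "v x div m = v' x div m" "colour (v x mod m) = colour (v' x mod m)"
    and "y \<in> S \<Longrightarrow> v x div m \<le> v y div m + 2 \<Longrightarrow> v y div m \<le> v x div m + 2 \<Longrightarrow>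
      (v x mod m < v y mod m \<longleftrightarrow> v' x mod m < v' y mod m)"
proof -
  obtain lo hi where h: "lo + 3 * 2 ^ r \<le> hi"
     "\<forall>x\<in>S. v x < l * m \<and> v' x < l * m \<and> v x div m = v' x div m \<and>
        (v x div m \<le> lo \<or> hi \<le> v x div m)"
     "ef m colour r (column_pairs v v' {x\<in>S. v x div m \<le> lo})"
     "ef m colour r (column_pairs v v' {x\<in>S. hi \<le> v x div m})"
    using assms unfolding similar_def by blast
  note iso = h(3,4)[THEN ef_partial_iso[OF m_pos]]
  have "(1::nat) \<le> 2 ^ r" by simp
  then have gap: "lo + 2 < hi" using h(1) by linarith
  show "v x div m = v' x div m" using h(2) assms(2) by blast
  show "colour (v x mod m) = colour (v' x mod m)"
    using iso h(2) assms(2) by (auto simp: partial_iso_def column_pairs_def)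
  assume y: "y \<in> S" "v x div m \<le> v y div m + 2" "v y div m \<le> v x div m + 2"
  have "v x div m \<le> lo \<or> hi \<le> v x div m" "v y div m \<le> lo \<or> hi \<le> v y div m"
    using h(2) assms(2) y(1) by blast+
  then have "v x div m \<le> lo \<and> v y div m \<le> lo \<or> hi \<le> v x div m \<and> hi \<le> v y div m"
    using gap y(2,3) by linarith
  then show "v x mod m < v y mod m \<longleftrightarrow> v' x mod m < v' y mod m"
    using iso assms(2) y(1) by (auto simp: partial_iso_def column_pairs_def)
qed

lemma less_layer_column:
  "(x::nat) < y \<longleftrightarrow> x div m < y div m \<or> x div m = y div m \<and> x mod m < y mod m"
proof (cases "x div m" "y div m" rule: linorder_cases)
  case less
  then show ?thesis using div_le_mono[of y x m] by (meson leD leI)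
next
  case equal
  have "x div m * m + x mod m = x" "y div m * m + y mod m = y" by simp_all
  with equal have "x < y \<longleftrightarrow> x mod m < y mod m" by (metis nat_add_left_cancel_less)
  then show ?thesis using equal by simp
next
  case greater
  then show ?thesis using div_le_mono[of x y m] by auto
qed

text \<open>No closeness is required: distinct layers decide the order by themselves, and pebbles of
  one layer share a cluster. Hence the order never compares columns across clusters.\<close>

lemma similar_less:
  assumes "similar r S v v'" "x \<in> S" "y \<in> S"
  shows "v x < v y \<longleftrightarrow> v' x < v' y"
proof (cases "v x div m = v y div m")
  case True
  then show ?thesis
    using similar_atoms(1,3)[OF assms(1,2)] similar_atoms(1)[OF assms(1,3)] assms(3)
      less_layer_column[of "v x" "v y"] less_layer_column[of "v' x" "v' y"] by simp
next
  case False
  then show ?thesis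
    using similar_atoms(1)[OF assms(1,2)] similar_atoms(1)[OF assms(1,3)]
      less_layer_column[of "v x" "v y"] less_layer_column[of "v' x" "v' y"] by simp
qed

lemma similar_atom:
  assumes "similar r S v v'" "set xs \<subseteq> S" "s \<in> \<Sigma>"
  shows "map v xs \<in> I s \<longleftrightarrow> map v' xs \<in> I s"
  using relations[OF assms(3)]
proof (elim disjE exE conjE)
  fix R assume R: "\<forall>(i, j)\<in>R. i \<le> j + 2 \<and> j \<le> i + 2"
    and I: "I s = {[x, y] | x y. (x, y) \<in> columns m R}"
  show ?thesis
  proof (cases "length xs = 2")
    case True
    then obtain x y where xs: "xs = [x, y]"
      by (auto simp: numeral_2_eq_2 length_Suc_conv)
    then have xy: "x \<in> S" "y \<in> S" using assms(2) by auto
    note sx = similar_atoms[OF assms(1) xy(1)] and sy = similar_atoms[OF assms(1) xy(2)]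
    have "(v x, v y) \<in> columns m R \<longleftrightarrow> (v' x, v' y) \<in> columns m R"
    proof (cases "(v x div m, v y div m) \<in> R")
      case True
      then have "v x div m \<le> v y div m + 2" "v y div m \<le> v x div m + 2" using R by auto
      \<comment> \<open>Equality of columns is the failure of both strict comparisons.\<close>
      then have "v x mod m = v y mod m \<longleftrightarrow> v' x mod m = v' y mod m"
        using sx(3)[OF xy(2)] sy(3)[OF xy(1)] by (metis linorder_neq_iff)
      then show ?thesis using sx(1) sy(1) by (simp add: columns_def)
    next
      case False
      then show ?thesis using sx(1) sy(1) by (simp add: columns_def)
    qed
    then show ?thesis by (simp add: I xs)
  next
    case False
    then show ?thesis by (auto simp: I dest: arg_cong[of _ _ length])
  qed
next
  assume I: "I s \<subseteq> range (\<lambda>x. [x])"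
  show ?thesis
  proof (cases "length xs = 1")
    case True
    then obtain x where xs: "xs = [x]" by (auto simp: length_Suc_conv)
    then have x: "x \<in> S" using assms(2) by auto
    have l: "v x div m < l" using assms(1) x m_pos by (auto simp: similar_def div_less_iff_less_mult)
    note sx = similar_atoms[OF assms(1) x]
    have "[v x div m * m + v x mod m] \<in> I s \<longleftrightarrow> [v x div m * m + v' x mod m] \<in> I s"
      using arg_cong[OF sx(2), of "\<lambda>C. (s, v x div m) \<in> C"] l assms(3)
      by (simp add: colour_def del: div_mult_mod_eq)
    moreover have "v x div m * m + v' x mod m = v' x" by (simp add: sx(1))
    ultimately show ?thesis by (simp add: xs)
  next
    case False
    then have "map u xs \<notin> I s" for u using I by (auto dest: arg_cong[of _ _ length])
    then show ?thesis by simp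
  qed
qed

text \<open>The usual game argument: existential witnesses and universal counterexamples are
  transferred by \<open>similar_extend\<close>.\<close>

lemma eval_similar:
  assumes "similar r S v v'" "qrank \<phi> \<le> r" "fv \<phi> \<subseteq> S" "syms \<phi> \<subseteq> \<Sigma>"
  shows "eval (l * m) I v \<phi> \<longleftrightarrow> eval (l * m) I v' \<phi>"
  using assms
proof (induction \<phi> arbitrary: r S v v')
  case (Atom s xs)
  then show ?case using similar_atom[OF Atom.prems(1), of xs s] by simp
next
  case (Eq x y)
  then have "v x < v y \<longleftrightarrow> v' x < v' y" "v y < v x \<longleftrightarrow> v' y < v' x"
    using similar_less[OF Eq.prems(1), of x y] similar_less[OF Eq.prems(1), of y x] by auto
  then show ?case by (metis eval.simps(2) linorder_neq_iff)
next
  case (Lt x y)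
  then show ?case using similar_less[OF Lt.prems(1), of x y] by simp
next
  case (Ex i \<phi>)
  then obtain q where r: "r = Suc q" "qrank \<phi> \<le> q" by (cases r) auto
  have IH: "eval (l * m) I u \<phi> \<longleftrightarrow> eval (l * m) I u' \<phi>" if "similar q (insert i S) u u'" for u u'
    by (rule Ex.IH[OF that]) (use Ex.prems r in auto)
  have "\<exists>b<l * m. eval (l * m) I (u'(i := b)) \<phi>"
    if "similar r S u u'" "a < l * m" "eval (l * m) I (u(i := a)) \<phi>" for u u' a
    using similar_extend[of q S u u' a i] that r IH by blast
  then show ?case using Ex.prems(1) similar_sym[OF Ex.prems(1)] by auto
next
  case (All i \<phi>)
  then obtain q where r: "r = Suc q" "qrank \<phi> \<le> q" by (cases r) auto
  have IH: "eval (l * m) I u \<phi> \<longleftrightarrow> eval (l * m) I u' \<phi>" if "similar q (insert i S) u u'" for u u'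
    by (rule All.IH[OF that]) (use All.prems r in auto)
  have "\<exists>b<l * m. \<not> eval (l * m) I (u'(i := b)) \<phi>"
    if "similar r S u u'" "a < l * m" "\<not> eval (l * m) I (u(i := a)) \<phi>" for u u' a
    using similar_extend[of q S u u' a i] that r IH by blast
  then show ?case using All.prems(1) similar_sym[OF All.prems(1)] by auto
qed (simp; blast)+

end
text \<open>Each node is a cluster of its own, with \<open>lo = 0\<close> and
  \<open>hi = l - 1\<close>. The low game starts from \<open>(a, a)\<close> and the high one from
  \<open>(a, b)\<close>; nothing forces the two to agree.\<close>

lemma (in column_structure) formula_confuses_columns:
  assumes "qrank \<phi> \<le> r" "fv \<phi> \<subseteq> {0, 1}" "syms \<phi> \<subseteq> \<Sigma>" "3 * 2 ^ r < l"
    and "a < m" "b < m" "ef m colour r {(a, b)}"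
  shows "eval (l * m) I (lval [a, (l - 1) * m + a]) \<phi> \<longleftrightarrow>
    eval (l * m) I (lval [a, (l - 1) * m + b]) \<phi>"
proof -
  have node: "(l - 1) * m + c < l * m" if "c < m" for c
  proof -
    have "(l - 1) * m + m = l * m" using assms(4) by (cases l) auto
    then show ?thesis using that by linarith
  qed
  have "m \<le> l * m" using assms(4) by (cases l) auto
  then have "a < l * m" using assms(5) by linarith
  define v v' where "v = lval [a, (l - 1) * m + a]" and "v' = lval [a, (l - 1) * m + b]"
  have v: "v 0 = a" "v' 0 = a" "v 1 = (l - 1) * m + a" "v' 1 = (l - 1) * m + b"
    by (simp_all add: v_def v'_def lval_def)
  have d: "v 0 div m = 0" "v' 0 div m = 0" "v 1 div m = l - 1" "v' 1 div m = l - 1"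
    using assms(5,6) by (simp_all only: v) auto
  have md: "v 0 mod m = a" "v' 0 mod m = a" "v 1 mod m = a" "v' 1 mod m = b"
    using assms(5,6) by (simp_all only: v) auto
  have "(1::nat) \<le> 2 ^ r" by simp
  then have "l > 1" using assms(4) by linarith
  have sets: "{x \<in> {0, 1}. v x div m \<le> 0} = {0}" "{x \<in> {0, 1}. l - 1 \<le> v x div m} = {1}"
    using d \<open>l > 1\<close> by auto
  have "similar r {0, 1} v v'"
    unfolding similar_def
  proof (intro exI conjI)
    show "0 + 3 * 2 ^ r \<le> l - 1" using assms(4) by simp
    show "ef m colour r (column_pairs v v' {x \<in> {0, 1}. v x div m \<le> 0})"
      unfolding sets by (rule ef_identity) (simp add: column_pairs_def md)
    show "ef m colour r (column_pairs v v' {x \<in> {0, 1}. l - 1 \<le> v x div m})"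
      unfolding sets using assms(7) md by (simp add: column_pairs_def)
    have "v 0 < l * m" "v' 0 < l * m" "v 1 < l * m" "v' 1 < l * m"
      using v \<open>a < l * m\<close> node assms(5,6) by presburger+
    then show "\<forall>x\<in>{0, 1}. v x < l * m \<and> v' x < l * m \<and> v x div m = v' x div m \<and>
        (v x div m \<le> 0 \<or> l - 1 \<le> v x div m)"
      using d by auto
  qed
  then show ?thesis unfolding v_def[symmetric] v'_def[symmetric]
    using assms(1-3) by (rule eval_similar)
qed

section \<open>The hard graphs\<close>

text \<open>With \<open>x\<^sub>i = 3i\<close>, \<open>y\<^sub>i = 3i + 1\<close> and \<open>z\<^sub>i = 3i + 2\<close> the edges are
  \<open>x\<^sub>i \<rightarrow> z\<^sub>i\<close> and \<open>x\<^sub>i\<^sub>+\<^sub>1 \<rightarrow> y\<^sub>i \<rightarrow> z\<^sub>i\<close>. All paths have length at most 2, but both change queries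
  connect \<open>x\<^sub>i\<close> to \<open>x\<^sub>i\<^sub>+\<^sub>1\<close>; the detour through \<open>y\<^sub>i\<close> lets an acyclic query tell the two apart.\<close>

definition zigzag :: "nat \<Rightarrow> (nat \<times> nat) set" where
  "zigzag L = {(i, j). i \<le> 3 * L \<and> j \<le> 3 * L \<and>
     (i mod 3 = 0 \<and> (j = i + 2 \<or> i = j + 2) \<or> i mod 3 = 1 \<and> j = i + 1)}"

text \<open>The only paths of two edges are \<open>x\<^sub>i\<^sub>+\<^sub>1 \<rightarrow> y\<^sub>i
  \<rightarrow> z\<^sub>i\<close>, which end one layer below their start. This makes the query
  relation local before the change.\<close>

lemma zigzag_rtrancl:
  assumes "(i, j) \<in> (zigzag L)\<^sup>*"
  shows "i \<le> j + 2 \<and> j \<le> i + 2"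
proof -
  have "i = j \<or> i mod 3 = 0 \<and> (j = i + 2 \<or> i = j + 2 \<or> i = j + 1) \<or> i mod 3 = 1 \<and> j = i + 1"
    using assms
  proof (induction rule: rtrancl_induct)
    case (step j k)
    from step.hyps(2) have "j mod 3 = 0 \<and> (k = j + 2 \<or> j = k + 2) \<or> j mod 3 = 1 \<and> k = j + 1"
      by (simp add: zigzag_def)
    with step.IH show ?case by (elim disjE conjE; presburger)
  qed simp
  then show ?thesis by auto
qed

section \<open>Runs of dynamic programs and the lower bound\<close>

lemma run_snoc: "run n \<rho> k upd (cs @ [c]) = step n \<rho> k upd (run n \<rho> k upd cs) c"
  by (simp add: run_def)

lemma run_insertions:
  "fst (run n \<rho> k upd (map (\<lambda>(u, v). (InsE, [u, v])) es)) = set es"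
proof (induction es rule: rev_induct)
  case Nil
  then show ?case by (simp add: run_def init_state_def)
next
  case (snoc e es)
  then show ?case by (cases e) (simp add: run_snoc step_def new_input_def)
qed

lemma finite_schema: "finite (schema k)"
proof -
  have "schema k = {Es, Aux Qs} \<union> (\<lambda>i. Aux (Us i)) ` {..<k}"
    by (auto simp: schema_def aux_in_def)
  then show ?thesis by simp
qed

text \<open>Common core of both claims. The class must contain all subgraphs of the hard graph,
  since single insertions pass through some of them, and one change must link the two ends of each
  column.\<close>

lemma not_maintainable:
  assumes wf: "wf_prog k upd" and maint: "maintains cls \<rho> k upd"
    and cls: "\<And>m L E. m > 0 \<Longrightarrow> E \<subseteq> columns m (zigzag L) \<Longrightarrow> cls E"
    and rho: "\<And>m L. m > 0 \<Longrightarrow> \<exists>F. (0, 3 * L) \<in> F\<^sup>* \<and> cls (columns m F) \<and>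
      (\<forall>st. fst st = columns m (zigzag L) \<longrightarrow>
        new_input ((3 * L + 1) * m) \<rho> st RhoC [] = columns m F)"
  shows False
proof -
  define \<phi> where "\<phi> = upd RhoC Qs"
  define q where "q = qrank \<phi>"
  \<comment> \<open>This gives \<open>l = 3 * 2 ^ q + 1\<close>, just above the distance that rank
    \<open>q\<close> can bridge.\<close>
  define L :: nat where "L = 2 ^ q"
  define l where "l = 3 * L + 1"
  have "finite (Pow (schema k \<times> {..<l}))" using finite_schema by simp
  from ef_finite_index[OF this, of 1 q]
  obtain N :: nat where N: "\<And>m w. range w \<subseteq> Pow (schema k \<times> {..<l}) \<Longrightarrow>
    \<exists>f. \<forall>xs. length xs = 1 \<longrightarrow> f xs < N \<and>
      (\<forall>ys. length ys = 1 \<longrightarrow> f xs = f ys \<longrightarrow> ef m w q (set (zip xs ys)))"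
    by blast
  \<comment> \<open>One column more than there are types; possible because \<open>N\<close> was
    fixed before \<open>m\<close>.\<close>
  define m where "m = Suc N"
  have m: "m > 0" by (simp add: m_def)
  define G where "G = columns m (zigzag L)"
  have G_bounded: "G \<subseteq> {..<l * m} \<times> {..<l * m}"
    unfolding G_def by (rule columns_bounded[OF m]) (auto simp: zigzag_def l_def)
  then obtain es where es: "set es = G"
    using finite_list finite_subset by (metis finite_SigmaI finite_lessThan)
  \<comment> \<open>An explicit edge is needed because correctness is promised only after a nonempty
    change sequence.\<close>
  have "L > 0" by (simp add: L_def)
  then have "(0, 2) \<in> zigzag L" by (simp add: zigzag_def)
  then have "(0 * m + 0, 2 * m + 0) \<in> G" unfolding G_def by (subst columns_node) (use m in auto)
  then have "es \<noteq> []" using es by auto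
  define cs where "cs = map (\<lambda>(u, v). (InsE, [u, v])) es"
  define st where "st = run (l * m) \<rho> k upd cs"
  have E: "fst st = G" unfolding st_def cs_def run_insertions es ..
  obtain F where F: "(0, 3 * L) \<in> F\<^sup>*" "cls (columns m F)"
    "new_input (l * m) \<rho> st RhoC [] = columns m F"
    using rho[OF m, of L] E unfolding G_def l_def by blast
  have valid: "\<forall>ch\<in>set cs. valid_chg (l * m) ch"
    using G_bounded es by (auto simp: cs_def valid_chg_def)
  have cls_take: "cls (fst (run (l * m) \<rho> k upd (take i cs)))" for i
  proof -
    have "fst (run (l * m) \<rho> k upd (take i cs)) = set (take i es)"
      unfolding cs_def take_map run_insertions ..
    then show ?thesis using cls[OF m, of "set (take i es)" L] es set_take_subset[of i es]
      by (auto simp: G_def)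
  qed
  have "snd st Qs = reach (l * m) (fst st)"
    using maint valid cls_take \<open>es \<noteq> []\<close> unfolding maintains_def st_def
    by (auto simp: cs_def)
  \<comment> \<open>The closure is reflexive on all natural numbers, hence the cut to the
    \<open>l\<close> layers.\<close>
  also have "\<dots> = {[x, y] | x y. (x, y) \<in> columns m ((zigzag L)\<^sup>* \<inter> {..<l} \<times> {..<l})}"
    using m unfolding E G_def reach_def columns_rtrancl[OF m]
    by (auto simp: columns_def div_less_iff_less_mult)
  finally have Q: "snd st Qs = \<dots>" .
  let ?cs = "cs @ [(RhoC, [])]"
  have run: "run (l * m) \<rho> k upd ?cs = step (l * m) \<rho> k upd st (RhoC, [])"
    by (simp add: run_snoc st_def)
  have "cls (fst (run (l * m) \<rho> k upd (take i ?cs)))" for i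
  proof (cases "i \<le> length cs")
    case True
    then show ?thesis using cls_take by simp
  next
    case False
    then have "take i ?cs = ?cs" by simp
    then show ?thesis using F(2,3) run by (simp add: step_def)
  qed
  moreover have "\<forall>ch\<in>set ?cs. valid_chg (l * m) ch" using valid by (simp add: valid_chg_def)
  ultimately have "snd (run (l * m) \<rho> k upd ?cs) Qs = reach (l * m) (fst (run (l * m) \<rho> k upd ?cs))"
    using maint unfolding maintains_def by blast
  then have "{bs. length bs = 2 \<and> set bs \<subseteq> {..<l * m} \<and> eval (l * m) (interp st) (lval bs) \<phi>}
      = reach (l * m) (columns m F)"
    unfolding run using F(3) by (simp add: step_def aux_in_def \<phi>_def)
  \<comment> \<open>The update formula, read in the state before the change, must already decide
    reachability after it.\<close>
  then have update: "eval (l * m) (interp st) (lval [x, y]) \<phi> \<longleftrightarrow> (x, y) \<in> columns m (F\<^sup>*)"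
    if "x < l * m" "y < l * m" for x y
    using that by (auto simp: set_eq_iff reach_def columns_rtrancl[OF m] dest!: spec[of _ "[x, y]"])

  have unary: "snd st (Us i) \<subseteq> range (\<lambda>x. [x])" for i
  proof -
    obtain cs' c ps where "cs = cs' @ [(c, ps)]"
      using \<open>es \<noteq> []\<close> by (metis cs_def list.map_disc_iff rev_exhaust surj_pair)
    then show ?thesis by (auto simp: st_def run_snoc step_def length_Suc_conv)
  qed
  interpret column_structure m l "interp st" "schema k"
  proof
    fix s assume s: "s \<in> schema k"
    show "(\<exists>R. (\<forall>(i, j)\<in>R. i \<le> j + 2 \<and> j \<le> i + 2) \<and>
        interp st s = {[x, y] | x y. (x, y) \<in> columns m R}) \<or> interp st s \<subseteq> range (\<lambda>x. [x])"
    proof (cases s)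
      case Es
      then show ?thesis using E unfolding G_def
        by (intro disjI1 exI[of _ "zigzag L"]) (auto simp: interp_def zigzag_def)
    next
      case (Aux a)
      show ?thesis
      proof (cases a)
        case Qs
        then show ?thesis using Aux Q zigzag_rtrancl[of _ _ L]
          by (intro disjI1 exI[of _ "(zigzag L)\<^sup>* \<inter> {..<l} \<times> {..<l}"]) (auto simp: interp_def)
      next
        case (Us i)
        then show ?thesis using Aux unary[of i] by (simp add: interp_def)
      qed
    qed
  qed (rule m)
  have "range colour \<subseteq> Pow (schema k \<times> {..<l})" by (auto simp: colour_def)
  then obtain f where f: "\<And>xs. length xs = 1 \<Longrightarrow> f xs < N"
    "\<And>xs ys. length xs = 1 \<Longrightarrow> length ys = 1 \<Longrightarrow> f xs = f ys \<Longrightarrow> ef m colour q (set (zip xs ys))"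
    using N[of colour m] by blast
  have "(\<lambda>a. f [a]) ` {..<m} \<subseteq> {..<N}" using f(1) by auto
  then have "\<not> inj_on (\<lambda>a. f [a]) {..<m}"
    using card_inj_on_le[of "\<lambda>a. f [a]" "{..<m}" "{..<N}"] by (auto simp: m_def)
  then obtain a b where ab: "a < m" "b < m" "a \<noteq> b" "f [a] = f [b]" by (auto simp: inj_on_def)
  then have "ef m colour q {(a, b)}" using f(2)[of "[a]" "[b]"] by simp
  \<comment> \<open>\<open>RhoC\<close> has no parameters, so the variables of the queried pair are
    \<open>0\<close> and \<open>1\<close>.\<close>
  moreover have "fv \<phi> \<subseteq> {0, 1}" "syms \<phi> \<subseteq> schema k"
    using wf by (force simp: wf_prog_def \<phi>_def aux_in_def lessThan_def)+
  ultimately have "eval (l * m) (interp st) (lval [a, (l - 1) * m + a]) \<phi> \<longleftrightarrow>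
      eval (l * m) (interp st) (lval [a, (l - 1) * m + b]) \<phi>"
    using ab by (intro formula_confuses_columns[of \<phi> q]) (auto simp: q_def L_def l_def)
  moreover have "l * m = (l - 1) * m + m" "m \<le> l * m" by (simp_all add: l_def)
  then have "a < l * m" "(l - 1) * m + a < l * m" "(l - 1) * m + b < l * m" using ab by linarith+
  ultimately have "(a, (l - 1) * m + a) \<in> columns m (F\<^sup>*) \<longleftrightarrow> (a, (l - 1) * m + b) \<in> columns m (F\<^sup>*)"
    using update by blast
  moreover have "(a, (l - 1) * m + c) \<in> columns m (F\<^sup>*) \<longleftrightarrow> a = c" if "c < m" for c
    using columns_node[of a m c 0 "l - 1" "F\<^sup>*"] ab(1) that F(1) by (simp add: l_def)
  ultimately show False using ab by blast
qed

section \<open>The two change queries\<close>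

lemma rtrancl_multiples_3:
  fixes L :: nat
  assumes "\<And>i. i < L \<Longrightarrow> (3 * i, 3 * i + 3) \<in> F\<^sup>*"
  shows "(0, 3 * L) \<in> F\<^sup>*"
proof -
  have "i \<le> L \<Longrightarrow> (0, 3 * i) \<in> F\<^sup>*" for i
  proof (induction i)
    case (Suc i)
    then show ?case using assms[of i] by (auto intro: rtrancl_trans simp: add.commute)
  qed simp
  then show ?thesis by simp
qed

text \<open>Only the inserted disjunct is written, since \<open>new_input\<close> keeps the old
  edges.\<close>

definition rev_query :: "sym fo" where
  "rev_query = Atom Es [1, 0]"

text \<open>With reversed edges available, \<open>x\<^sub>i \<rightarrow> z\<^sub>i \<rightarrow>
  y\<^sub>i \<rightarrow> x\<^sub>i\<^sub>+\<^sub>1\<close> is a path.\<close>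

lemma rev_query_rtrancl: "(0, 3 * L) \<in> (zigzag L \<union> (zigzag L)\<inverse>)\<^sup>*"
proof (rule rtrancl_multiples_3)
  fix i assume "i < L"
  define S where "S = zigzag L \<union> (zigzag L)\<inverse>"
  have "(3 * i, 3 * i + 2) \<in> S" "(3 * i + 2, 3 * i + 1) \<in> S" "(3 * i + 1, 3 * i + 3) \<in> S"
    using \<open>i < L\<close> by (auto simp: S_def zigzag_def)
  then show "(3 * i, 3 * i + 3) \<in> S\<^sup>*" by (meson converse_rtrancl_into_rtrancl rtrancl.rtrancl_refl)
qed

lemma new_input_rev_query:
  assumes "fst st \<subseteq> {..<n} \<times> {..<n}"
  shows "new_input n rev_query st RhoC [] = fst st \<union> (fst st)\<inverse>"
  using assms by (auto simp: new_input_def rev_query_def interp_def lval_def)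

text \<open>Variables \<open>2\<close> and \<open>3\<close> stand for \<open>z\<^sub>i\<close> and
  \<open>y\<^sub>i\<close>. The inequality excludes \<open>y\<^sub>i\<close> as a source; an edge
  from it to \<open>x\<^sub>i\<^sub>+\<^sub>1\<close> would close a cycle.\<close>

definition skip_query :: "sym fo" where
  "skip_query = Ex 2 (Ex 3 (Conj (Neg (Eq 0 3))
     (Conj (Atom Es [0, 2]) (Conj (Atom Es [1, 3]) (Atom Es [3, 2])))))"

lemma new_input_skip_query:
  assumes "fst st \<subseteq> {..<n} \<times> {..<n}"
  shows "new_input n skip_query st RhoC [] = fst st \<union>
    {(x, y). \<exists>z u. x \<noteq> u \<and> (x, z) \<in> fst st \<and> (y, u) \<in> fst st \<and> (u, z) \<in> fst st}"
  using assms by (fastforce simp: new_input_def skip_query_def interp_def lval_def)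

definition skips :: "nat \<Rightarrow> (nat \<times> nat) set" where
  "skips L = {(i, j). i mod 3 = 0 \<and> j = i + 3 \<and> j \<le> 3 * L}"

lemma columns_Un: "columns m (F \<union> F') = columns m F \<union> columns m F'"
  by (auto simp: columns_def)

text \<open>The path from \<open>j\<close> over \<open>u\<close> to \<open>z\<close> has two edges,
  so \<open>u\<close> is some \<open>y\<^sub>k\<close> and \<open>z\<close> is
  \<open>z\<^sub>k\<close>. The only predecessor of \<open>z\<^sub>k\<close> other than
  \<open>u\<close> is \<open>x\<^sub>k\<close>.\<close>

lemma zigzag_skip:
  assumes "i \<noteq> u" "(i, z) \<in> zigzag L" "(j, u) \<in> zigzag L" "(u, z) \<in> zigzag L"
  shows "(i, j) \<in> skips L"
proof -
  have "j mod 3 = 0 \<and> (u = j + 2 \<or> j = u + 2) \<or> j mod 3 = 1 \<and> u = j + 1"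
    "u mod 3 = 0 \<and> (z = u + 2 \<or> u = z + 2) \<or> u mod 3 = 1 \<and> z = u + 1"
    using assms(3,4) by (auto simp: zigzag_def)
  then have u: "u mod 3 = 1 \<and> z = u + 1 \<and> j = u + 2"
    by (elim disjE conjE; presburger)
  have "i mod 3 = 0 \<and> (z = i + 2 \<or> i = z + 2) \<or> i mod 3 = 1 \<and> z = i + 1"
    using assms(2) by (auto simp: zigzag_def)
  then have "i mod 3 = 0 \<and> j = i + 3"
    using u assms(1) by (elim disjE conjE; presburger)
  moreover have "j \<le> 3 * L" using assms(3) by (simp add: zigzag_def)
  ultimately show ?thesis by (simp add: skips_def)
qed

lemma skip_columns:
  fixes m L :: nat
  assumes "m > 0"
  defines "G \<equiv> columns m (zigzag L)"
  shows "{(x, y). \<exists>z u. x \<noteq> u \<and> (x, z) \<in> G \<and> (y, u) \<in> G \<and> (u, z) \<in> G} = columns m (skips L)"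
    (is "?A = _")
proof (intro equalityI subrelI)
  fix x y assume "(x, y) \<in> ?A"
  then obtain z u where xu: "x \<noteq> u" and zu: "(x, z) \<in> G" "(y, u) \<in> G" "(u, z) \<in> G" by blast
  then have cols: "x mod m = z mod m" "y mod m = u mod m" "u mod m = z mod m"
    and layers: "(x div m, z div m) \<in> zigzag L" "(y div m, u div m) \<in> zigzag L"
      "(u div m, z div m) \<in> zigzag L"
    by (auto simp: G_def columns_def)
  \<comment> \<open>Distinct nodes of the same column lie in distinct layers.\<close>
  have "x div m \<noteq> u div m" using xu cols by (metis div_mult_mod_eq)
  with layers have "(x div m, y div m) \<in> skips L"
    by (intro zigzag_skip)
  then show "(x, y) \<in> columns m (skips L)" using cols by (simp add: columns_def)
next
  fix x y assume "(x, y) \<in> columns m (skips L)"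
  then obtain i j a where a: "a < m" "x = i * m + a" "y = j * m + a" and ij: "(i, j) \<in> skips L"
    using assms(1) by (rule columns_cases)
  have "i mod 3 = 0" "j = i + 3" "j \<le> 3 * L" using ij by (auto simp: skips_def)
  moreover from this have "(i + 1) mod 3 = 1" "j mod 3 = 0" by presburger+
  ultimately have "(i, i + 2) \<in> zigzag L" "(j, i + 1) \<in> zigzag L" "(i + 1, i + 2) \<in> zigzag L"
    by (auto simp: zigzag_def)
  then have "(x, (i + 2) * m + a) \<in> G" "(y, (i + 1) * m + a) \<in> G"
    "((i + 1) * m + a, (i + 2) * m + a) \<in> G"
    unfolding G_def a using a(1) by (simp_all only: columns_node simp_thms)
  moreover have "x \<noteq> (i + 1) * m + a" using a assms(1) by simp
  ultimately show "(x, y) \<in> ?A" by blast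
qed

text \<open>A topological order: first all \<open>x\<^sub>i\<close> by index, then all
  \<open>y\<^sub>i\<close>, then all \<open>z\<^sub>i\<close>.\<close>

lemma acyclic_skip_columns: "acyclic (columns m (zigzag L \<union> skips L))"
proof -
  define rank where "rank i = (if i mod 3 = 0 then i else 3 * L + i mod 3)" for i :: nat
  have "rank i < rank j" if "(i, j) \<in> zigzag L \<union> skips L" for i j
  proof -
    have "i \<le> 3 * L \<and> (i mod 3 = 0 \<and> (j = i + 2 \<or> i = j + 2) \<or> i mod 3 = 1 \<and> j = i + 1
        \<or> i mod 3 = 0 \<and> j = i + 3)"
      using that by (auto simp: zigzag_def skips_def)
    then have "i mod 3 = 0 \<and> i \<le> 3 * L \<and> (j mod 3 \<noteq> 0 \<or> i < j \<and> j mod 3 = 0)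
        \<or> i mod 3 = 1 \<and> j mod 3 = 2"
      by presburger
    then show ?thesis by (auto simp: rank_def)
  qed
  then have "columns m (zigzag L \<union> skips L) \<subseteq> measure (\<lambda>x. rank (x div m))"
    by (auto simp: columns_def)
  then show ?thesis by (meson acyclic_subset wf_acyclic wf_measure)
qed

theorem theorem7p1:
  shows "(\<exists>\<rho>. graph_query \<rho> \<and> qfree \<rho> \<and>
            \<not> (\<exists>k upd. wf_prog k upd \<and> maintains (\<lambda>_. True) \<rho> k upd))
       \<and> (\<exists>\<rho>'. graph_query \<rho>' \<and> existential \<rho>' \<and>
            \<not> (\<exists>k upd. wf_prog k upd \<and> maintains acyclic \<rho>' k upd))"
proof (intro conjI)
  have bounded: "columns m (zigzag L) \<subseteq> {..<(3 * L + 1) * m} \<times> {..<(3 * L + 1) * m}"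
    if "m > 0" for m L
    using that by (rule columns_bounded) (auto simp: zigzag_def)
  have "\<not> (\<exists>k upd. wf_prog k upd \<and> maintains (\<lambda>_. True) rev_query k upd)"
  proof (intro notI, elim exE conjE)
    fix k upd assume "wf_prog k upd" "maintains (\<lambda>_. True) rev_query k upd"
    then show False
    proof (rule not_maintainable)
      fix m L :: nat assume m: "m > 0"
      have "columns m (zigzag L \<union> (zigzag L)\<inverse>) = columns m (zigzag L) \<union> (columns m (zigzag L))\<inverse>"
        by (auto simp: columns_def)
      then show "\<exists>F. (0, 3 * L) \<in> F\<^sup>* \<and> True \<and> (\<forall>st. fst st = columns m (zigzag L) \<longrightarrow>
          new_input ((3 * L + 1) * m) rev_query st RhoC [] = columns m F)"
        using rev_query_rtrancl[of L] bounded[OF m, of L] new_input_rev_query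
        by (intro exI[of _ "zigzag L \<union> (zigzag L)\<inverse>"]) simp
    qed simp
  qed
  then show "\<exists>\<rho>. graph_query \<rho> \<and> qfree \<rho> \<and>
      \<not> (\<exists>k upd. wf_prog k upd \<and> maintains (\<lambda>_. True) \<rho> k upd)"
    by (intro exI[of _ rev_query] conjI) (simp_all add: graph_query_def rev_query_def)
  have "\<not> (\<exists>k upd. wf_prog k upd \<and> maintains acyclic skip_query k upd)"
  proof (intro notI, elim exE conjE)
    fix k upd assume "wf_prog k upd" "maintains acyclic skip_query k upd"
    then show False
    proof (rule not_maintainable)
      fix m L :: nat assume m: "m > 0"
      have "(0, 3 * L) \<in> (zigzag L \<union> skips L)\<^sup>*"
        by (rule rtrancl_multiples_3) (auto simp: skips_def)
      then show "\<exists>F. (0, 3 * L) \<in> F\<^sup>* \<and> acyclic (columns m F) \<and>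
          (\<forall>st. fst st = columns m (zigzag L) \<longrightarrow>
            new_input ((3 * L + 1) * m) skip_query st RhoC [] = columns m F)"
        using acyclic_skip_columns bounded[OF m, of L] skip_columns[OF m, of L]
        by (intro exI[of _ "zigzag L \<union> skips L"]) (simp add: new_input_skip_query columns_Un)
    next
      fix m L :: nat and E assume "E \<subseteq> columns m (zigzag L)"
      then show "acyclic E"
        using acyclic_skip_columns[of m L] by (auto simp: columns_Un intro: acyclic_subset)
    qed
  qed
  moreover have "existential skip_query"
    unfolding existential_def skip_query_def
    by (intro exI[of _ "[2, 3]"] exI conjI) (simp, simp)
  ultimately show "\<exists>\<rho>'. graph_query \<rho>' \<and> existential \<rho>' \<and>
      \<not> (\<exists>k upd. wf_prog k upd \<and> maintains acyclic \<rho>' k upd)"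
    by (intro exI[of _ skip_query] conjI) (auto simp: graph_query_def skip_query_def)
qed

end
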